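(* For all integers $s\geq 1$, we have $$\mathrm{EN}_{s,2}(2143)(q)=q^{(2s-1)(s-1)}(1+q)^{s-1}.$$
   Context: For integers $s,t\ge 1$, $\mathrm{EN}_{s,t}$ is the rectangular poset on the label set $\{1,\ldots,st\}$ whose labels are arranged in $s$ rows of length $t$, row $i$ (for $0\le i\le s-1$) being $it+1,it+2,\ldots,it+t$, and whose order is generated by the relations $it+j<_{\mathrm{EN}} it+j+1$ for $0\le i\le s-1$, $1\le j\le t-1$, and $(i+1)t+j<_{\mathrm{EN}} it+j$ for $0\le i\le s-2$, $1\le j\le t$. A linear extension of $\mathrm{EN}_{s,t}$ is viewed as a permutation $\pi=\pi_1\cdots\pi_{st}\in S_{st}$ of the labels in which $a$ appears before $b$ whenever $a<_{\mathrm{EN}}b$. For example, the linear extensions of $\mathrm{EN}_{3,2}$ are $531642,536142,536412,563142,563412$. A permutation $\sigma=\sigma_1\cdots\sigma_n$ contains the pattern $\tau=\tau_1\cdots\tau_m\in S_m$ if there are indices $i_1<\cdots<i_m$ such that for all $j,l\in\{1,\ldots,m\}$ one has $\sigma_{i_j}<\sigma_{i_l}$ if and only if $\tau_j<\tau_l$; otherwise $\sigma$ avoids $\tau$. $\mathrm{EN}_{s,t}(\tau)$ is the set of linear extensions of $\mathrm{EN}_{s,t}$ that avoid $\tau$. An inversion of $\pi$ is a pair $(i,j)$ with $i<j$ and $\pi_i>\pi_j$, and $\mathrm{inv}(\pi)$ is the number of inversions of $\pi$. Finally, $\mathrm{EN}_{s,t}(\tau)(q)=\sum_{\pi\in \mathrm{EN}_{s,t}(\tau)}q^{\mathrm{inv}(\pi)}$.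 *)

theory Defs
  imports
    "HOL-Combinatorics.Multiset_Permutations"
    "HOL-Computational_Algebra.Polynomial"
begin

text \<open>
  Permutations in \<open>S\<^sub>n\<close> are lists in one-line notation, i.e. the elements of
  \<open>permutations_of_set {1..n}\<close>. The entry \<open>\<pi>\<^sub>i\<close> is \<open>\<pi> ! (i - 1)\<close>, because list positions
  start at 0.
\<close>

definition EN_gen :: "nat \<Rightarrow> nat \<Rightarrow> (nat \<times> nat) set" where
  "EN_gen s t =
     {(i * t + j, i * t + j + 1) | i j. i < s \<and> 1 \<le> j \<and> j + 1 \<le> t} \<union>
     {((i + 1) * t + j, i * t + j) | i j. i + 1 < s \<and> 1 \<le> j \<and> j \<le> t}"

text \<open>The strict order of the poset on the labels \<open>{1..s * t}\<close>.\<close>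

definition EN_less :: "nat \<Rightarrow> nat \<Rightarrow> (nat \<times> nat) set" where
  "EN_less s t = (EN_gen s t)\<^sup>+"

definition appears_before :: "'a list \<Rightarrow> 'a \<Rightarrow> 'a \<Rightarrow> bool" where
  "appears_before xs a b \<longleftrightarrow> (\<exists>p q. p < q \<and> q < length xs \<and> xs ! p = a \<and> xs ! q = b)"

definition EN_linear_extensions :: "nat \<Rightarrow> nat \<Rightarrow> nat list set" where
  "EN_linear_extensions s t =
     {\<pi> \<in> permutations_of_set {1..s * t}. \<forall>(a, b) \<in> EN_less s t. appears_before \<pi> a b}"

definition contains_pattern :: "nat list \<Rightarrow> nat list \<Rightarrow> bool" where
  "contains_pattern \<sigma> \<tau> \<longleftrightarrow>
     (\<exists>f. strict_mono_on {..<length \<tau>} f \<and>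
          (\<forall>j < length \<tau>. f j < length \<sigma>) \<and>
          (\<forall>j < length \<tau>. \<forall>l < length \<tau>. \<sigma> ! f j < \<sigma> ! f l \<longleftrightarrow> \<tau> ! j < \<tau> ! l))"

definition EN_avoiding :: "nat \<Rightarrow> nat \<Rightarrow> nat list \<Rightarrow> nat list set" where
  "EN_avoiding s t \<tau> = {\<pi> \<in> EN_linear_extensions s t. \<not> contains_pattern \<pi> \<tau>}"

definition inversion_count :: "nat list \<Rightarrow> nat" where
  "inversion_count \<pi> = card {(i, j). i < j \<and> j < length \<pi> \<and> \<pi> ! i > \<pi> ! j}"

text \<open>The sum ranges over a subset of the finite set \<open>permutations_of_set {1..s * t}\<close>;
  \<open>monom 1 k\<close> is \<open>q\<^sup>k\<close> in the polynomial ring over the integers.\<close>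

definition EN_poly :: "nat \<Rightarrow> nat \<Rightarrow> nat list \<Rightarrow> int poly" where
  "EN_poly s t \<tau> = (\<Sum>\<pi> \<in> EN_avoiding s t \<tau>. monom 1 (inversion_count \<pi>))"

end

theory Submission
  imports Defs "HOL-Library.Sublist"
begin

text \<open>
  Write \<open>a\<^sub>i = 2i + 1\<close> and \<open>b\<^sub>i = 2i + 2\<close> for the two labels of row \<open>i\<close>. If both \<open>a\<^sub>i\<^sub>-\<^sub>1\<close> and
  \<open>a\<^sub>i\<^sub>-\<^sub>2\<close> precede \<open>b\<^sub>i\<close>, then \<open>a\<^sub>i\<^sub>-\<^sub>1 a\<^sub>i\<^sub>-\<^sub>2 b\<^sub>i b\<^sub>i\<^sub>-\<^sub>1\<close> is a 2143. Hence the avoiding linear extensions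
  are exactly the words \<open>a\<^sub>s\<^sub>-\<^sub>1 {b\<^sub>s\<^sub>-\<^sub>1, a\<^sub>s\<^sub>-\<^sub>2} \<dots> {b\<^sub>1, a\<^sub>0} b\<^sub>0\<close> in which each braced pair is put
  in either order. Adding a new top row therefore extends each word in two ways, which create
  \<open>4n + 3\<close> and \<open>4n + 4\<close> inversions when there were \<open>n + 1\<close> rows before.
\<close>

section \<open>Order conditions and pattern containment as statements about subsequences\<close>

lemma subseq_conv_index_map:
  "subseq xs ys \<longleftrightarrow> (\<exists>f. strict_mono_on {..<length xs} f \<and>
     (\<forall>j<length xs. f j < length ys \<and> ys ! f j = xs ! j))" (is "_ \<longleftrightarrow> ?P xs ys")
proof
  assume "subseq xs ys"
  then show "?P xs ys"
  proof (induction rule: list_emb.induct)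
    case (list_emb_Nil ys)
    show ?case by (auto simp: strict_mono_on_def)
  next
    case (list_emb_Cons xs ys y)
    then obtain f where "strict_mono_on {..<length xs} f"
      "\<forall>j<length xs. f j < length ys \<and> ys ! f j = xs ! j" by blast
    then show ?case
      by (intro exI[of _ "\<lambda>j. Suc (f j)"]) (auto simp: strict_mono_on_def)
  next
    case (list_emb_Cons2 x y xs ys)
    then obtain f where "strict_mono_on {..<length xs} f"
      "\<forall>j<length xs. f j < length ys \<and> ys ! f j = xs ! j" by blast
    with list_emb_Cons2 show ?case
      \<comment> \<open>The matched head goes to position 0, and every later position moves up by
        one.\<close>
      by (intro exI[of _ "case_nat 0 (\<lambda>j. Suc (f j))"])
        (auto simp: strict_mono_on_def split: nat.splits)
  qed
next
  assume "?P xs ys"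
  then show "subseq xs ys"
  proof (induction xs arbitrary: ys)
    case (Cons x xs)
    then obtain f where mono: "strict_mono_on {..<Suc (length xs)} f"
      and nth: "\<And>j. j < Suc (length xs) \<Longrightarrow> f j < length ys \<and> ys ! f j = (x # xs) ! j"
      by auto
    have less: "f i < f j" if "i < j" "j < Suc (length xs)" for i j
      using mono that by (auto simp: strict_mono_on_def)
    \<comment> \<open>\<open>zs\<close> is what follows the position matched to \<open>x\<close>.
      Monotonicity puts all later matches in \<open>zs\<close>, with their indices lowered by
      \<open>Suc (f 0)\<close>.\<close>
    define zs where "zs = drop (Suc (f 0)) ys"
    have "?P xs zs"
    proof (intro exI[of _ "\<lambda>j. f (Suc j) - Suc (f 0)"] conjI allI impI)
      show "strict_mono_on {..<length xs} (\<lambda>j. f (Suc j) - Suc (f 0))"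
      proof (rule strict_mono_onI)
        fix i j assume "i \<in> {..<length xs}" "j \<in> {..<length xs}" "i < j"
        then show "f (Suc i) - Suc (f 0) < f (Suc j) - Suc (f 0)"
          using less[of 0 "Suc i"] less[of "Suc i" "Suc j"] by auto
      qed
    next
      fix j assume "j < length xs"
      then show "f (Suc j) - Suc (f 0) < length zs" "zs ! (f (Suc j) - Suc (f 0)) = xs ! j"
        using less[of 0 "Suc j"] nth[of "Suc j"] by (auto simp: zs_def)
    qed
    then have "subseq xs zs" by (rule Cons.IH)
    moreover have "ys = take (f 0) ys @ x # zs"
      using nth[of 0] id_take_nth_drop[of "f 0" ys] by (simp add: zs_def)
    ultimately show ?case
      by (metis subseq_Cons2 list_emb_append2)
  qed simp
qed

lemma appears_before_iff_subseq: "appears_before xs a b \<longleftrightarrow> subseq [a, b] xs"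
proof
  assume "appears_before xs a b"
  then obtain p q where "p < q" "q < length xs" "xs ! p = a" "xs ! q = b"
    by (auto simp: appears_before_def)
  then show "subseq [a, b] xs"
    unfolding subseq_conv_index_map
    by (intro exI[of _ "case_nat p (\<lambda>_. q)"])
      (auto simp: strict_mono_on_def less_Suc_eq split: nat.splits)
next
  assume "subseq [a, b] xs"
  then obtain f where "strict_mono_on {..<length [a, b]} f"
    "\<forall>j<length [a, b]. f j < length xs \<and> xs ! f j = [a, b] ! j"
    unfolding subseq_conv_index_map by blast
  then show "appears_before xs a b"
    unfolding appears_before_def
    by (intro exI[of _ "f 0"] exI[of _ "f 1"]) (auto simp: strict_mono_on_def All_less_Suc2)
qed

lemma contains_pattern_iff_subseq:
  "contains_pattern \<sigma> \<tau> \<longleftrightarrow> (\<exists>\<rho>. length \<rho> = length \<tau> \<and> subseq \<rho> \<sigma> \<and>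
     (\<forall>j<length \<tau>. \<forall>l<length \<tau>. \<rho> ! j < \<rho> ! l \<longleftrightarrow> \<tau> ! j < \<tau> ! l))"
proof
  assume "contains_pattern \<sigma> \<tau>"
  then obtain f where f: "strict_mono_on {..<length \<tau>} f" "\<forall>j<length \<tau>. f j < length \<sigma>"
    "\<forall>j<length \<tau>. \<forall>l<length \<tau>. \<sigma> ! f j < \<sigma> ! f l \<longleftrightarrow> \<tau> ! j < \<tau> ! l"
    unfolding contains_pattern_def by blast
  define \<rho> where "\<rho> = map (\<lambda>j. \<sigma> ! f j) [0..<length \<tau>]"
  have "subseq \<rho> \<sigma>"
    unfolding subseq_conv_index_map using f by (intro exI[of _ f]) (auto simp: \<rho>_def)
  with f show "\<exists>\<rho>. length \<rho> = length \<tau> \<and> subseq \<rho> \<sigma> \<and>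
     (\<forall>j<length \<tau>. \<forall>l<length \<tau>. \<rho> ! j < \<rho> ! l \<longleftrightarrow> \<tau> ! j < \<tau> ! l)"
    by (intro exI[of _ \<rho>]) (auto simp: \<rho>_def)
next
  assume "\<exists>\<rho>. length \<rho> = length \<tau> \<and> subseq \<rho> \<sigma> \<and>
     (\<forall>j<length \<tau>. \<forall>l<length \<tau>. \<rho> ! j < \<rho> ! l \<longleftrightarrow> \<tau> ! j < \<tau> ! l)"
  then show "contains_pattern \<sigma> \<tau>"
    unfolding contains_pattern_def subseq_conv_index_map by metis
qed

text \<open>The letters are named by size, a < b < c < d, so that b a d c is the order 2143. Only
  the three consecutive comparisons are recorded; the other comparisons of the pattern
  follow.\<close>

definition contains_2143 :: "nat list \<Rightarrow> bool" where
  "contains_2143 \<sigma> \<longleftrightarrow> (\<exists>b a d c. subseq [b, a, d, c] \<sigma> \<and> a < b \<and> b < c \<and> c < d)"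

lemma contains_pattern_2143_iff: "contains_pattern \<sigma> [2, 1, 4, 3] \<longleftrightarrow> contains_2143 \<sigma>"
proof
  assume "contains_pattern \<sigma> [2, 1, 4, 3]"
  then obtain \<rho> where \<rho>: "length \<rho> = 4" "subseq \<rho> \<sigma>"
    "\<forall>j<4. \<forall>l<4. \<rho> ! j < \<rho> ! l \<longleftrightarrow> [2, 1, 4, 3 :: nat] ! j < [2, 1, 4, 3] ! l"
    unfolding contains_pattern_iff_subseq by (auto simp: eval_nat_numeral)
  from \<rho>(1) obtain b a d c where "\<rho> = [b, a, d, c]"
    by (auto simp: eval_nat_numeral length_Suc_conv)
  moreover from this \<rho>(3) have "a < b" "b < c" "c < d"
    by (auto simp: eval_nat_numeral All_less_Suc2)
  ultimately show "contains_2143 \<sigma>"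
    using \<rho>(2) unfolding contains_2143_def by blast
next
  assume "contains_2143 \<sigma>"
  then obtain b a d c where "subseq [b, a, d, c] \<sigma>" "a < b" "b < c" "c < d"
    unfolding contains_2143_def by blast
  then show "contains_pattern \<sigma> [2, 1, 4, 3]"
    unfolding contains_pattern_iff_subseq
    by (intro exI[of _ "[b, a, d, c]"]) (auto simp: All_less_Suc2)
qed

lemma contains_2143_mono: "contains_2143 \<sigma> \<Longrightarrow> subseq \<sigma> \<sigma>' \<Longrightarrow> contains_2143 \<sigma>'"
  unfolding contains_2143_def by (meson subseq_order.trans)

text \<open>Distinctness identifies the occurrence of b behind a with the occurrence of b in front
  of c.\<close>

lemma appears_before_trans:
  assumes "distinct xs" "appears_before xs a b" "appears_before xs b c"
  shows "appears_before xs a c"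
proof -
  from assms(2) obtain p q where pq: "p < q" "q < length xs" "xs ! p = a" "xs ! q = b"
    by (auto simp: appears_before_def)
  from assms(3) obtain q' r where qr: "q' < r" "r < length xs" "xs ! q' = b" "xs ! r = c"
    by (auto simp: appears_before_def)
  have "q = q'"
    using pq qr assms(1) by (metis less_trans nth_eq_iff_index_eq)
  with pq qr show ?thesis
    unfolding appears_before_def by (intro exI[of _ p] exI[of _ r]) simp
qed

text \<open>For a fixed repetition-free word, appearing before is a transitive relation, so it
  contains the transitive closure \<open>EN_less\<close> as soon as it contains the
  generators.\<close>

lemma EN_linear_extensions_iff:
  "\<pi> \<in> EN_linear_extensions s t \<longleftrightarrow>
     distinct \<pi> \<and> set \<pi> = {1..s * t} \<and> (\<forall>(a, b) \<in> EN_gen s t. subseq [a, b] \<pi>)"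
proof -
  have "(\<forall>(a, b) \<in> EN_less s t. appears_before \<pi> a b) \<longleftrightarrow>
        (\<forall>(a, b) \<in> EN_gen s t. appears_before \<pi> a b)" if "distinct \<pi>"
  proof
    assume gen: "\<forall>(a, b) \<in> EN_gen s t. appears_before \<pi> a b"
    have "appears_before \<pi> a b" if "(a, b) \<in> (EN_gen s t)\<^sup>+" for a b
      using that
    proof induction
      case (base y)
      with gen show ?case by blast
    next
      case (step y z)
      with gen show ?case by (blast intro: appears_before_trans[OF \<open>distinct \<pi>\<close>])
    qed
    then show "\<forall>(a, b) \<in> EN_less s t. appears_before \<pi> a b"
      by (auto simp: EN_less_def)
  qed (auto simp: EN_less_def)
  then show ?thesis
    by (auto simp: EN_linear_extensions_def permutations_of_set_def appears_before_iff_subseq)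
qed

section \<open>The generating relations for two columns\<close>

lemma EN_gen_2:
  "EN_gen s 2 = {(2 * i + 1, 2 * i + 2) | i. i < s} \<union> {(k + 2, k) | k. 1 \<le> k \<and> k + 2 \<le> 2 * s}"
proof -
  have "{(i * 2 + j, i * 2 + j + 1) | i j. i < s \<and> 1 \<le> j \<and> j + 1 \<le> 2} =
        {(2 * i + 1, 2 * i + 2) | i. i < s}"
  proof (intro equalityI subsetI)
    fix e assume "e \<in> {(i * 2 + j, i * 2 + j + 1) | i j. i < s \<and> 1 \<le> j \<and> j + 1 \<le> 2}"
    then obtain i j where "e = (i * 2 + j, i * 2 + j + 1)" "i < s" "j = 1"
      by fastforce
    then show "e \<in> {(2 * i + 1, 2 * i + 2) | i. i < s}" by auto
  next
    fix e assume "e \<in> {(2 * i + 1, 2 * i + 2) | i. i < s}"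
    then obtain i where "e = (i * 2 + 1, i * 2 + 1 + 1)" "i < s" by auto
    then show "e \<in> {(i * 2 + j, i * 2 + j + 1) | i j. i < s \<and> 1 \<le> j \<and> j + 1 \<le> 2}"
      by fastforce
  qed
  moreover have "{((i + 1) * 2 + j, i * 2 + j) | i j. i + 1 < s \<and> 1 \<le> j \<and> j \<le> 2} =
        {(k + 2, k) | k. 1 \<le> k \<and> k + 2 \<le> 2 * s}"
  proof (intro equalityI subsetI)
    fix e assume "e \<in> {(k + 2, k) | k. 1 \<le> k \<and> k + 2 \<le> 2 * s}"
    then obtain k where k: "e = (k + 2, k)" "1 \<le> k" "k + 2 \<le> 2 * s" by auto
    \<comment> \<open>Division by 2 with the remainder taken from {1, 2}, since columns are counted
      from 1.\<close>
    define i j where "i = (k - 1) div 2" and "j = (k - 1) mod 2 + 1"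
    have "k = i * 2 + j" "1 \<le> j" "j \<le> 2"
      using k(2) by (auto simp: i_def j_def)
    moreover from this k have "e = ((i + 1) * 2 + j, i * 2 + j)" "i + 1 < s" by auto
    ultimately show "e \<in> {((i + 1) * 2 + j, i * 2 + j) | i j. i + 1 < s \<and> 1 \<le> j \<and> j \<le> 2}"
      by blast
  qed auto
  ultimately show ?thesis
    unfolding EN_gen_def by simp
qed

text \<open>The new row carries the largest labels but lies lowest in the order. All three new
  relations therefore start at a new label, and the relations among the old labels stay the
  same.\<close>

lemma EN_gen_2_Suc:
  "EN_gen (Suc (Suc n)) 2 =
     {(2 * n + 3, 2 * n + 4), (2 * n + 3, 2 * n + 1), (2 * n + 4, 2 * n + 2)} \<union> EN_gen (Suc n) 2"
proof -
  have "{(2 * i + 1, 2 * i + 2) | i. i < Suc (Suc n)} =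
      insert (2 * n + 3, 2 * n + 4) {(2 * i + 1, 2 * i + 2) | i. i < Suc n}"
    by (fastforce simp: less_Suc_eq[of _ "Suc n"] intro: exI[of _ "Suc n"])
  moreover have "k = 2 * n + 1 \<or> k = 2 * n + 2 \<or> k + 2 \<le> 2 * Suc n"
    if "k + 2 \<le> 2 * Suc (Suc n)" for k
    using that by presburger
  then have "{(k + 2, k) | k. 1 \<le> k \<and> k + 2 \<le> 2 * Suc (Suc n)} =
      {(2 * n + 3, 2 * n + 1), (2 * n + 4, 2 * n + 2)} \<union> {(k + 2, k) | k. 1 \<le> k \<and> k + 2 \<le> 2 * Suc n}"
    by auto
  ultimately show ?thesis
    unfolding EN_gen_2 by (simp add: insert_commute)
qed

section \<open>The first entries of an avoiding word\<close>

definition EN2_avoiding :: "nat \<Rightarrow> nat list set" where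
  "EN2_avoiding s = EN_avoiding s 2 [2, 1, 4, 3]"

lemma EN2_avoiding_iff:
  "\<pi> \<in> EN2_avoiding s \<longleftrightarrow> distinct \<pi> \<and> set \<pi> = {1..2 * s} \<and>
     (\<forall>(a, b) \<in> EN_gen s 2. subseq [a, b] \<pi>) \<and> \<not> contains_2143 \<pi>"
  unfolding EN2_avoiding_def EN_avoiding_def mem_Collect_eq EN_linear_extensions_iff
    contains_pattern_2143_iff by (simp add: mult.commute conj_assoc)

text \<open>Used in contrapositive form: in a repetition-free word the head has no predecessor in
  the order.\<close>

lemma in_set_tail_if_subseq: "subseq [y, x] (x # xs) \<Longrightarrow> x \<in> set xs"
  by (cases "x = y") (auto dest: list_emb_set)

lemma subseq_Cons_neqD: "subseq (x # xs) (y # ys) \<Longrightarrow> x \<noteq> y \<Longrightarrow> subseq (x # xs) ys"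
  by simp

text \<open>The label 2s - 1 is the minimum of the poset. Every other label receives one explicit
  predecessor, which serves to exclude it from positions too early in a word.\<close>

lemma EN2_label_cases:
  assumes "x \<in> {1..2 * s}"
  obtains (first) "x + 1 = 2 * s"
    | (left) "x + 1 < 2 * s" "odd x" "(x + 2, x) \<in> EN_gen s 2"
    | (right) "even x" "x \<ge> 2" "(x - 1, x) \<in> EN_gen s 2"
proof (cases "odd x")
  case True
  have "x + 1 = 2 * s \<or> x + 2 \<le> 2 * s \<and> x + 1 < 2 * s"
    using True assms unfolding atLeastAtMost_iff by presburger
  with True assms show ?thesis
    using first left by (auto simp: EN_gen_2)
next
  case False
  with assms have "x \<ge> 2" "x = 2 * ((x - 2) div 2) + 2" "(x - 2) div 2 < s"
    by (auto elim!: evenE)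
  then obtain i where "x = 2 * i + 2" "i < s"
    by metis
  with False show ?thesis
    using right by (auto simp: EN_gen_2)
qed

lemma EN2_avoiding_hd:
  assumes "\<pi> \<in> EN2_avoiding (Suc n)"
  obtains \<tau> where "\<pi> = (2 * n + 1) # \<tau>"
proof (cases \<pi>)
  case Nil
  with assms show ?thesis by (simp add: EN2_avoiding_iff)
next
  case (Cons x \<tau>)
  with assms have x: "x \<in> {1..2 * Suc n}" "x \<notin> set \<tau>"
    by (auto simp: EN2_avoiding_iff)
  have no: "(y, x) \<notin> EN_gen (Suc n) 2" for y
    using assms in_set_tail_if_subseq[of y x \<tau>] x(2) Cons by (auto simp: EN2_avoiding_iff)
  from x(1) have "x = 2 * n + 1"
    by (cases rule: EN2_label_cases) (use no in auto)
  with Cons that show ?thesis by blast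
qed

lemma EN2_avoiding_1: "EN2_avoiding 1 = {[1, 2]}"
proof (intro equalityI subsetI)
  fix \<pi> assume \<pi>: "\<pi> \<in> EN2_avoiding 1"
  then obtain \<tau> where \<tau>: "\<pi> = 1 # \<tau>"
    using EN2_avoiding_hd[of \<pi> 0] by auto
  have "{1..2 * 1} = {1, 2 :: nat}"
    by auto
  with \<pi> \<tau> have "distinct \<tau>" "1 \<notin> set \<tau>" "insert 1 (set \<tau>) = insert 1 {2}"
    by (simp_all add: EN2_avoiding_iff)
  then have "distinct \<tau>" "set \<tau> = {2}"
    using insert_ident[of 1 "set \<tau>" "{2}"] by simp_all
  then have "\<tau> = [2]"
    by (cases \<tau>; cases "tl \<tau>") auto
  with \<tau> show "\<pi> \<in> {[1, 2]}" by simp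
next
  fix \<pi> :: "nat list" assume "\<pi> \<in> {[1, 2]}"
  then show "\<pi> \<in> EN2_avoiding 1"
    by (auto simp: EN2_avoiding_iff EN_gen_2 contains_2143_def split: if_splits)
qed

text \<open>The pair is \<open>2 * n + 4\<close> and \<open>2 * n + 1\<close>, the latter being the
  head of \<pi> in all uses; the suffix of the name tells in which order the two appear.\<close>

abbreviation add_pair_desc :: "nat \<Rightarrow> nat list \<Rightarrow> nat list" where
  "add_pair_desc n \<pi> \<equiv> (2 * n + 3) # (2 * n + 4) # \<pi>"

text \<open>\<open>tl\<close> removes the leading \<open>2 * n + 1\<close>, which is put back in
  front of \<open>2 * n + 4\<close>.\<close>

abbreviation add_pair_asc :: "nat \<Rightarrow> nat list \<Rightarrow> nat list" where
  "add_pair_asc n \<pi> \<equiv> (2 * n + 3) # (2 * n + 1) # (2 * n + 4) # tl \<pi>"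

text \<open>Erasing the top row leaves an avoiding word. Candidates for the second and third entries
  are limited by their predecessors, which must already have been placed; avoidance then forces
  \<open>2 * n + 4\<close> into one of these two places.\<close>

lemma EN2_avoiding_Suc_cases:
  assumes "\<pi> \<in> EN2_avoiding (Suc (Suc n))"
  obtains \<rho> where "\<rho> \<in> EN2_avoiding (Suc n)" "\<pi> = add_pair_desc n \<rho> \<or> \<pi> = add_pair_asc n \<rho>"
proof -
  have dist: "distinct \<pi>" and set: "set \<pi> = {1..2 * n + 4}"
    and gen: "\<And>a b. (a, b) \<in> EN_gen (Suc (Suc n)) 2 \<Longrightarrow> subseq [a, b] \<pi>"
    and avoid: "\<not> contains_2143 \<pi>"
    using assms by (auto simp: EN2_avoiding_iff)
  define \<rho> where "\<rho> = filter (\<lambda>x. x \<le> 2 * n + 2) \<pi>"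
  have "\<rho> \<in> EN2_avoiding (Suc n)"
    unfolding EN2_avoiding_iff
  proof (intro conjI ballI)
    show "distinct \<rho>" "set \<rho> = {1..2 * Suc n}"
      using dist set by (auto simp: \<rho>_def)
    show "\<not> contains_2143 \<rho>"
      using avoid contains_2143_mono[of \<rho> \<pi>] by (auto simp: \<rho>_def)
    fix e assume e: "e \<in> EN_gen (Suc n) 2"
    then obtain a b where ab: "e = (a, b)" "a \<le> 2 * n + 2" "b \<le> 2 * n + 2"
      unfolding EN_gen_2 by auto
    have "subseq (filter (\<lambda>x. x \<le> 2 * n + 2) [a, b]) \<rho>"
      unfolding \<rho>_def using e ab by (intro subseq_filter gen) (simp add: EN_gen_2_Suc)
    with ab show "case e of (a, b) \<Rightarrow> subseq [a, b] \<rho>" by simp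
  qed
  obtain \<pi>1 where \<pi>1: "\<pi> = (2 * n + 3) # \<pi>1"
    using EN2_avoiding_hd[OF assms] by (auto simp: eval_nat_numeral)
  have "2 * n + 4 \<in> set \<pi>"
    unfolding set by simp
  then have "2 * n + 4 \<in> set \<pi>1"
    by (simp add: \<pi>1)
  then obtain y \<pi>2 where \<pi>2: "\<pi>1 = y # \<pi>2"
    by (cases \<pi>1) auto
  have range: "x \<in> {1..2 * Suc (Suc n)}" if "x \<in> set \<pi>" for x
    using that unfolding set by simp
  have y: "y \<in> {1..2 * Suc (Suc n)}" "y \<notin> set \<pi>2" "y \<noteq> 2 * n + 3"
    using range[of y] dist \<pi>1 \<pi>2 by simp_all
  \<comment> \<open>Only the head stands before \<open>y\<close>, so it is the only possible
    predecessor of \<open>y\<close>.\<close>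
  have no_y: "z = 2 * n + 3" if "(z, y) \<in> EN_gen (Suc (Suc n)) 2" for z
    using gen[of z y] in_set_tail_if_subseq[of z y \<pi>2] y(2) \<pi>1 \<pi>2 subseq_Cons_neqD that by metis
  from y(1) have "y = 2 * n + 4 \<or> y = 2 * n + 1"
    by (cases rule: EN2_label_cases) (use y(3) in \<open>auto dest!: no_y\<close>)
  then show ?thesis
  proof
    assume y4: "y = 2 * n + 4"
    have "set \<pi>2 \<subseteq> {1..2 * n + 2}"
    proof
      fix x assume x: "x \<in> set \<pi>2"
      then have "x \<in> {1..2 * Suc (Suc n)}" "x \<noteq> 2 * n + 3" "x \<noteq> 2 * n + 4"
        using range[of x] dist \<pi>1 \<pi>2 y4 by auto
      then show "x \<in> {1..2 * n + 2}" by auto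
    qed
    then have "filter (\<lambda>x. x \<le> 2 * n + 2) \<pi>2 = \<pi>2"
      by (intro filter_True) auto
    then have "\<pi> = add_pair_desc n \<rho>"
      using \<pi>1 \<pi>2 y4 by (simp add: \<rho>_def)
    with \<open>\<rho> \<in> _\<close> that show ?thesis by blast
  next
    assume y1: "y = 2 * n + 1"
    have "2 * n + 4 \<in> set \<pi>2"
      using \<open>2 * n + 4 \<in> set \<pi>1\<close> \<pi>2 y1 by auto
    then obtain z \<pi>3 where \<pi>3: "\<pi>2 = z # \<pi>3"
      by (cases \<pi>2) auto
    have z: "z \<in> {1..2 * Suc (Suc n)}" "z \<notin> set \<pi>3" "z \<noteq> 2 * n + 3" "z \<noteq> 2 * n + 1"
      using range[of z] dist \<pi>1 \<pi>2 \<pi>3 y1 by simp_all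
    have no_z: "x = 2 * n + 3 \<or> x = 2 * n + 1" if "(x, z) \<in> EN_gen (Suc (Suc n)) 2" for x
      using gen[of x z] in_set_tail_if_subseq[of x z \<pi>3] z(2) \<pi>1 \<pi>2 \<pi>3 y1 subseq_Cons_neqD that
      by metis
    \<comment> \<open>Predecessors leave three candidates for \<open>z\<close>: 2n + 4, 2n + 2 and
      2n - 1. The label 2n + 2 has to wait for 2n + 4.\<close>
    have "z \<noteq> 2 * n + 2"
      using no_z[of "2 * n + 4"] by (auto simp: EN_gen_2_Suc)
    \<comment> \<open>This excludes z = 2n - 1, written without truncated subtraction. It is the one
      place where avoidance limits the choice: 2n + 1, 2n - 1, 2n + 4, 2n + 2 would form a
      2143.\<close>
    have "z + 1 \<noteq> 2 * n"
    proof
      assume z1: "z + 1 = 2 * n"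
      have "subseq [2 * n + 4, 2 * n + 2] \<pi>"
        by (rule gen) (simp add: EN_gen_2_Suc)
      then have "subseq [2 * n + 4, 2 * n + 2] \<pi>3"
        using \<pi>1 \<pi>2 \<pi>3 y1 z1 by (auto split: if_splits)
      then have "subseq [2 * n + 1, z, 2 * n + 4, 2 * n + 2] \<pi>"
        using \<pi>1 \<pi>2 \<pi>3 y1 z1 by auto
      then have "contains_2143 \<pi>"
        unfolding contains_2143_def using z1 
        by (intro exI[of _ "2 * n + 1"] exI[of _ z] exI[of _ "2 * n + 4"] exI[of _ "2 * n + 2"]) auto
      with avoid show False by blast
    qed
    from z(1) have z4: "z = 2 * n + 4"
      by (cases rule: EN2_label_cases) (use z(3,4) \<open>z \<noteq> 2 * n + 2\<close> \<open>z + 1 \<noteq> 2 * n\<close> in \<open>auto dest!: no_z\<close>)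
    have "set \<pi>3 \<subseteq> {1..2 * n + 2}"
    proof
      fix x assume x: "x \<in> set \<pi>3"
      then have "x \<in> {1..2 * Suc (Suc n)}" "x \<noteq> 2 * n + 3" "x \<noteq> 2 * n + 4"
        using range[of x] dist \<pi>1 \<pi>2 \<pi>3 z4 by auto
      then show "x \<in> {1..2 * n + 2}" by auto
    qed
    then have "filter (\<lambda>x. x \<le> 2 * n + 2) \<pi>3 = \<pi>3"
      by (intro filter_True) auto
    then have "\<pi> = add_pair_asc n \<rho>"
      using \<pi>1 \<pi>2 \<pi>3 y1 z4 by (simp add: \<rho>_def)
    with \<open>\<rho> \<in> _\<close> that show ?thesis by blast
  qed
qed

section \<open>Extending a word without creating a 2143\<close>

lemma contains_2143_Cons:
  "contains_2143 (x # xs) \<longleftrightarrow>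
     contains_2143 xs \<or> (\<exists>a d c. subseq [a, d, c] xs \<and> a < x \<and> x < c \<and> c < d)"
proof
  assume "contains_2143 (x # xs)"
  then obtain b a d c where s: "subseq [b, a, d, c] (x # xs)" "a < b" "b < c" "c < d"
    unfolding contains_2143_def by blast
  show "contains_2143 xs \<or> (\<exists>a d c. subseq [a, d, c] xs \<and> a < x \<and> x < c \<and> c < d)"
  proof (cases "b = x")
    case True
    with s(1) have "subseq [a, d, c] xs" by simp
    with s True show ?thesis by blast
  next
    case False
    with s show ?thesis
      unfolding contains_2143_def by (metis subseq_Cons_neqD)
  qed
next
  assume "contains_2143 xs \<or> (\<exists>a d c. subseq [a, d, c] xs \<and> a < x \<and> x < c \<and> c < d)"
  then show "contains_2143 (x # xs)"
    unfolding contains_2143_def by (meson list_emb_Cons subseq_Cons2)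
qed

text \<open>A head in the role of 2 needs two distinct larger values behind it, and the bound leaves
  room for only one. The slack of one lets \<open>2 * n + 3\<close> stand in front of
  \<open>2 * n + 4\<close>.\<close>

lemma contains_2143_Cons_large:
  assumes "\<And>y. y \<in> set xs \<Longrightarrow> y \<le> Suc x"
  shows "contains_2143 (x # xs) \<longleftrightarrow> contains_2143 xs"
proof -
  have "d \<le> Suc x" if "subseq [a, d, c] xs" for a d c
    using that by (auto elim: list_emb_set intro: assms)
  then show ?thesis
    unfolding contains_2143_Cons by fastforce
qed

lemma labels_Suc:
  "{1..2 * Suc (Suc n)} = insert (2 * n + 3) (insert (2 * n + 4) {1..2 * n + 2})"
proof -
  have "2 * Suc (Suc n) = Suc (Suc (2 * n + 2))" by simp
  then show ?thesis
    by (simp only: atLeastAtMostSuc_conv) (auto simp: atLeastAtMostSuc_conv)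
qed

lemma add_pair_desc_in:
  assumes "\<rho> \<in> EN2_avoiding (Suc n)"
  shows "add_pair_desc n \<rho> \<in> EN2_avoiding (Suc (Suc n))"
proof -
  have \<rho>: "distinct \<rho>" "set \<rho> = {1..2 * n + 2}" "\<not> contains_2143 \<rho>"
    and gen: "\<And>a b. (a, b) \<in> EN_gen (Suc n) 2 \<Longrightarrow> subseq [a, b] \<rho>"
    using assms by (auto simp: EN2_avoiding_iff)
  have "contains_2143 (add_pair_desc n \<rho>) \<longleftrightarrow> contains_2143 ((2 * n + 4) # \<rho>)"
    by (rule contains_2143_Cons_large) (auto simp: \<rho>(2))
  also have "\<dots> \<longleftrightarrow> contains_2143 \<rho>"
    by (rule contains_2143_Cons_large) (auto simp: \<rho>(2))
  finally have "\<not> contains_2143 (add_pair_desc n \<rho>)"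
    using \<rho>(3) by blast
  moreover have "subseq [a, b] (add_pair_desc n \<rho>)" if "(a, b) \<in> EN_gen (Suc (Suc n)) 2" for a b
  proof (cases "(a, b) \<in> EN_gen (Suc n) 2")
    case True
    then show ?thesis
      using gen by (metis list_emb_Cons)
  next
    case False
    with that have "(a, b) \<in> {(2 * n + 3, 2 * n + 4), (2 * n + 3, 2 * n + 1), (2 * n + 4, 2 * n + 2)}"
      unfolding EN_gen_2_Suc by blast
    moreover have "2 * n + 1 \<in> set \<rho>" "2 * n + 2 \<in> set \<rho>"
      unfolding \<rho>(2) by simp_all
    ultimately show ?thesis
      by (auto simp: subseq_singleton_left)
  qed
  moreover have "set (add_pair_desc n \<rho>) = {1..2 * Suc (Suc n)}"
    unfolding list.set \<rho>(2) labels_Suc ..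
  moreover have "distinct (add_pair_desc n \<rho>)"
    using \<rho>(1) by (simp add: \<rho>(2))
  ultimately show ?thesis
    unfolding EN2_avoiding_iff by blast
qed

lemma add_pair_asc_in:
  assumes "\<rho> \<in> EN2_avoiding (Suc n)"
  shows "add_pair_asc n \<rho> \<in> EN2_avoiding (Suc (Suc n))"
proof -
  obtain \<tau> where \<tau>: "\<rho> = (2 * n + 1) # \<tau>"
    using assms by (rule EN2_avoiding_hd)
  have \<rho>: "distinct \<rho>" "set \<rho> = {1..2 * n + 2}" "\<not> contains_2143 \<rho>"
    and gen: "\<And>a b. (a, b) \<in> EN_gen (Suc n) 2 \<Longrightarrow> subseq [a, b] \<rho>"
    using assms by (auto simp: EN2_avoiding_iff)
  have \<tau>_sub: "set \<tau> \<subseteq> {1..2 * n + 2}"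
    unfolding \<rho>(2)[symmetric] \<tau> by auto
  then have \<tau>_le: "x \<le> 2 * n + 2" if "x \<in> set \<tau>" for x
    using that by auto
  have "2 * n + 2 \<in> set \<rho>"
    unfolding \<rho>(2) by simp
  then have "2 * n + 2 \<in> set \<tau>"
    by (simp add: \<tau>)
  have "\<not> contains_2143 (add_pair_asc n \<rho>)"
  proof -
    have "\<not> contains_2143 \<tau>"
      using \<rho>(3) \<tau> contains_2143_mono[of \<tau> \<rho>] by auto
    moreover have "2 * n + 4 \<le> Suc (2 * n + 3)" "2 * n + 1 \<le> Suc (2 * n + 3)"
      by simp_all
    moreover have "y \<le> Suc (2 * n + 3)" "y \<le> Suc (2 * n + 4)" if "y \<in> set \<tau>" for y
      using \<tau>_le[OF that] by simp_all
    \<comment> \<open>The head \<open>2 * n + 1\<close> is the case not covered by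
      \<open>contains_2143_Cons_large\<close>. The smaller entry \<open>a\<close> lies behind
      \<open>2 * n + 4\<close>, so \<open>c\<close> and \<open>d\<close> come from
      \<open>\<tau>\<close>, where at most 2n + 2 exceeds 2n + 1.\<close>
    moreover have False
      if s: "subseq [a, d, c] ((2 * n + 4) # \<tau>)" and less: "a < 2 * n + 1" "2 * n + 1 < c" "c < d" for a d c
    proof -
      have "subseq [a, d, c] \<tau>"
        using s less(1) by simp
      then have "d \<in> set \<tau>"
        by (auto elim: list_emb_set)
      with less \<tau>_le[of d] show False by simp
    qed
    ultimately show ?thesis
      using contains_2143_Cons_large[of "(2 * n + 1) # (2 * n + 4) # \<tau>" "2 * n + 3"]
        contains_2143_Cons[of "2 * n + 1" "(2 * n + 4) # \<tau>"]
        contains_2143_Cons_large[of \<tau> "2 * n + 4"]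
      unfolding \<tau> list.sel by (metis set_ConsD)
  qed
  moreover have "subseq [a, b] (add_pair_asc n \<rho>)" if "(a, b) \<in> EN_gen (Suc (Suc n)) 2" for a b
  proof (cases "(a, b) \<in> EN_gen (Suc n) 2")
    case True
    \<comment> \<open>Moving \<open>2 * n + 1\<close> in front of \<open>2 * n + 4\<close> keeps the
      old labels in their old relative order.\<close>
    have "subseq \<rho> (add_pair_asc n \<rho>)"
      by (auto simp: \<tau>)
    with gen[OF True] show ?thesis
      using subseq_order.trans by blast
  next
    case False
    with that have "(a, b) \<in> {(2 * n + 3, 2 * n + 4), (2 * n + 3, 2 * n + 1), (2 * n + 4, 2 * n + 2)}"
      unfolding EN_gen_2_Suc by blast
    with \<open>2 * n + 2 \<in> set \<tau>\<close> show ?thesis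
      by (auto simp: \<tau> subseq_singleton_left)
  qed
  moreover have "set (add_pair_asc n \<rho>) = insert (2 * n + 3) (insert (2 * n + 4) (set \<rho>))"
    by (auto simp: \<tau>)
  then have "set (add_pair_asc n \<rho>) = {1..2 * Suc (Suc n)}"
    unfolding \<rho>(2) labels_Suc .
  moreover have "distinct (add_pair_asc n \<rho>)"
    using \<rho>(1) \<tau>_sub by (auto simp: \<tau>)
  ultimately show ?thesis
    unfolding EN2_avoiding_iff by blast
qed

lemma EN2_avoiding_Suc:
  "EN2_avoiding (Suc (Suc n)) =
     add_pair_desc n ` EN2_avoiding (Suc n) \<union> add_pair_asc n ` EN2_avoiding (Suc n)"
proof (intro equalityI subsetI)
  fix \<pi> assume "\<pi> \<in> EN2_avoiding (Suc (Suc n))"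
  then obtain \<rho> where "\<rho> \<in> EN2_avoiding (Suc n)" "\<pi> = add_pair_desc n \<rho> \<or> \<pi> = add_pair_asc n \<rho>"
    by (rule EN2_avoiding_Suc_cases)
  then show "\<pi> \<in> add_pair_desc n ` EN2_avoiding (Suc n) \<union> add_pair_asc n ` EN2_avoiding (Suc n)"
    by auto
qed (use add_pair_desc_in add_pair_asc_in in auto)

section \<open>Inversions and the generating polynomial\<close>

lemma inversion_count_Nil: "inversion_count [] = 0"
  by (simp add: inversion_count_def)

lemma inversion_count_Cons:
  "inversion_count (x # xs) = length (filter (\<lambda>y. y < x) xs) + inversion_count xs"
proof -
  let ?A = "{j. j < length xs \<and> xs ! j < x}"
  let ?B = "{(i, j). i < j \<and> j < length xs \<and> xs ! i > xs ! j}"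
  have fin: "finite ?B"
    by (rule finite_subset[of _ "{..<length xs} \<times> {..<length xs}"]) auto
  \<comment> \<open>Inversions are split by whether they involve position 0; the others are
    inversions of \<open>xs\<close> with both indices shifted.\<close>
  have "{(i, j). i < j \<and> j < length (x # xs) \<and> (x # xs) ! i > (x # xs) ! j} =
    (\<lambda>j. (0, Suc j)) ` ?A \<union> map_prod Suc Suc ` ?B" (is "?L = ?R")
  proof (intro equalityI subsetI)
    fix p assume "p \<in> ?L"
    then show "p \<in> ?R"
      by (cases p; cases "fst p"; cases "snd p") force+
  qed auto
  moreover have "card ?R = card ?A + card ?B"
    using fin by (subst card_Un_disjoint) (auto simp: card_image inj_on_def)
  ultimately show ?thesis
    by (simp add: inversion_count_def length_filter_conv_card)
qed

text \<open>In the descending case each new label precedes all 2n + 2 old labels and exceeds them.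
  In the ascending case just one inversion is lost, that of \<open>2 * n + 4\<close> with
  \<open>2 * n + 1\<close>.\<close>

lemma inversion_count_add_pair:
  assumes "\<rho> \<in> EN2_avoiding (Suc n)"
  shows "inversion_count (add_pair_desc n \<rho>) = 4 * n + 4 + inversion_count \<rho>"
    and "inversion_count (add_pair_asc n \<rho>) = 4 * n + 3 + inversion_count \<rho>"
proof -
  obtain \<tau> where \<tau>: "\<rho> = (2 * n + 1) # \<tau>"
    using assms by (rule EN2_avoiding_hd)
  have \<rho>: "distinct \<rho>" "set \<rho> = {1..2 * n + 2}"
    using assms by (auto simp: EN2_avoiding_iff)
  then have len: "length \<rho> = 2 * n + 2"
    using distinct_card[of \<rho>] by simp
  then have len': "length \<tau> = 2 * n + 1" 
    by (simp add: \<tau>)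
  have all: "filter (\<lambda>x. x < 2 * n + 3) \<rho> = \<rho>" "filter (\<lambda>x. x < 2 * n + 4) \<rho> = \<rho>"
    by (auto simp: \<rho>(2) intro!: filter_True)
  then have all': "filter (\<lambda>x. x < 2 * n + 3) \<tau> = \<tau>" "filter (\<lambda>x. x < 2 * n + 4) \<tau> = \<tau>"
    by (auto simp: \<tau>)
  show "inversion_count (add_pair_desc n \<rho>) = 4 * n + 4 + inversion_count \<rho>"
    by (simp add: inversion_count_Cons all len)
  show "inversion_count (add_pair_asc n \<rho>) = 4 * n + 3 + inversion_count \<rho>"
    by (simp add: inversion_count_Cons all' len' \<tau>)
qed

lemma EN_poly_2143_Suc:
  "EN_poly (Suc (Suc n)) 2 [2, 1, 4, 3] =
     monom 1 (4 * n + 3) * (1 + monom 1 1) * EN_poly (Suc n) 2 [2, 1, 4, 3]"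
proof -
  let ?A = "EN2_avoiding (Suc n)"
  let ?m = "\<lambda>\<pi>. monom (1 :: int) (inversion_count \<pi>)"
  have fin: "finite ?A"
    by (simp add: EN2_avoiding_def EN_avoiding_def EN_linear_extensions_def)
  \<comment> \<open>\<open>add_pair_asc\<close> forgets the head of its argument, so injectivity
    rests on all words in \<open>?A\<close> having the same head.\<close>
  have inj: "inj_on (add_pair_asc n) ?A"
  proof (rule inj_onI)
    fix \<rho> \<rho>' assume "\<rho> \<in> ?A" "\<rho>' \<in> ?A" and eq: "add_pair_asc n \<rho> = add_pair_asc n \<rho>'"
    then obtain \<tau> \<tau>' where "\<rho> = (2 * n + 1) # \<tau>" "\<rho>' = (2 * n + 1) # \<tau>'"
      by (meson EN2_avoiding_hd)
    with eq show "\<rho> = \<rho>'" by simp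
  qed
  have inj': "inj_on (add_pair_desc n) ?A"
    by (auto intro: inj_onI)
  \<comment> \<open>The second entries differ: \<open>2 * n + 4\<close> against
    \<open>2 * n + 1\<close>.\<close>
  have disj: "add_pair_desc n ` ?A \<inter> add_pair_asc n ` ?A = {}"
    by auto
  have "EN_poly (Suc (Suc n)) 2 [2, 1, 4, 3] =
      (\<Sum>\<rho>\<in>?A. ?m (add_pair_desc n \<rho>)) + (\<Sum>\<rho>\<in>?A. ?m (add_pair_asc n \<rho>))"
    unfolding EN_poly_def EN2_avoiding_def[symmetric] EN2_avoiding_Suc using fin disj inj inj'
    by (simp add: sum.union_disjoint sum.reindex)
  also have "\<dots> = (\<Sum>\<rho>\<in>?A. monom 1 (4 * n + 3) * (1 + monom 1 1) * ?m \<rho>)"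
    unfolding sum.distrib[symmetric]
  proof (rule sum.cong[OF refl])
    fix \<rho> assume "\<rho> \<in> ?A"
    then show "?m (add_pair_desc n \<rho>) + ?m (add_pair_asc n \<rho>) =
        monom 1 (4 * n + 3) * (1 + monom 1 1) * ?m \<rho>"
      unfolding inversion_count_add_pair[OF \<open>\<rho> \<in> ?A\<close>]
      by (simp add: mult_monom distrib_left distrib_right add_ac numeral_eq_Suc)
  qed
  finally show ?thesis
    by (simp add: EN_poly_def EN2_avoiding_def sum_distrib_left)
qed

theorem theorem3p2:
  fixes s :: nat
  assumes "s \<ge> 1"
  shows "EN_poly s 2 [2, 1, 4, 3] = monom 1 ((2 * s - 1) * (s - 1)) * (1 + monom 1 1) ^ (s - 1)"
proof -
  \<comment> \<open>With s = n + 1 the exponent (2s - 1)(s - 1) becomes (2n + 1)n, free of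
    natural-number subtraction.\<close>
  have "EN_poly (Suc n) 2 [2, 1, 4, 3] = monom 1 ((2 * n + 1) * n) * (1 + monom 1 1) ^ n" for n
  proof (induction n)
    case 0
    show ?case
      using EN2_avoiding_1 by (simp add: EN_poly_def EN2_avoiding_def inversion_count_Cons inversion_count_Nil)
  next
    case (Suc n)
    have "(2 * Suc n + 1) * Suc n = 4 * n + 3 + (2 * n + 1) * n"
      by (simp add: algebra_simps)
    then have "monom 1 ((2 * Suc n + 1) * Suc n) =
        monom (1 :: int) (4 * n + 3) * monom 1 ((2 * n + 1) * n)"
      by (simp only: mult_monom mult_1)
    then show ?case
      by (simp only: EN_poly_2143_Suc Suc.IH power_Suc mult_ac)
  qed
  from this[of "s - 1"] show ?thesis
    using assms by (cases s) simp_all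
qed

end
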